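(* Consider the eight $\square_q$-module structures I, IS, IT, IST, II, IIS, IIT, IIST on the vector space $\mathbb V/J$ listed in the context. The elements $x_1$ and $x_3$ act on the algebra $\mathbb V/J$ as derivations of the following sort: \begin{itemize} \item for I and II: $x_1$ acts as a $(K,I)$-derivation and $x_3$ acts as a $(K^{-1},I)$-derivation; \item for IS and IIS: $x_1$ acts as an $(I,K)$-derivation and $x_3$ acts as an $(I,K^{-1})$-derivation; \item for IT and IIT: $x_1$ acts as a $(K^{-1},I)$-derivation and $x_3$ acts as a $(K,I)$-derivation; \item for IST and IIST: $x_1$ acts as an $(I,K^{-1})$-derivation and $x_3$ acts as an $(I,K)$-derivation. \end{itemize}
   Context: Throughout, $\mathbb F$ is a field and $q\in\mathbb F$ is nonzero and not a root of unity. All vector spaces and algebras are over $\mathbb F$; algebras are associative with multiplicative identity. $[3]_q=(q^3-q^{-3})/(q-q^{-1})$ and $Q=1-q^2$. For an algebra $\mathcal A$ and automorphisms $\varphi,\phi$ of $\mathcal A$, a $(\varphi,\phi)$-derivation of $\mathcal A$ is an $\mathbb F$-linear map $\delta:\mathcal A\to\mathcal A$ with $\delta(uv)=\varphi(u)\delta(v)+\delta(u)\phi(v)$ for all $u,v\in\mathcal A$. $I$ is the identity map. The algebra $\square_q$ is defined by generators $\{x_i\}_{i\in\mathbb Z_4}$ ($\mathbb Z_4=\mathbb Z/4\mathbb Z$) and relations, for $i\in\mathbb Z_4$: $\frac{q x_ix_{i+1}-q^{-1}x_{i+1}x_i}{q-q^{-1}}=1$ and $x_i^3x_{i+2}-[3]_q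 x_i^2x_{i+2}x_i+[3]_q x_ix_{i+2}x_i^2-x_{i+2}x_i^3=0$. Let $\mathbb V$ be the free algebra on two generators $A,B$. A word of length $n$ is a product $v_1v_2\cdots v_n$ with each $v_i\in\{A,B\}$ (the word of length $0$ is $1$); the words form the standard basis of $\mathbb V$. Let $(\,,\,)$ be the bilinear form on $\mathbb V$ for which the words are orthonormal. ${\rm End}(\mathbb V)$ is the algebra of $\mathbb F$-linear maps $\mathbb V\to\mathbb V$ whose matrix with respect to the standard basis has finitely many nonzero entries in each row; each $X\in{\rm End}(\mathbb V)$ has a unique adjoint $X^*\in{\rm End}(\mathbb V)$ with $(Xu,v)=(u,X^*v)$ for all $u,v\in\mathbb V$. $K$ is the automorphism of the free algebra $\mathbb V$ with $A\mapsto q^2A$, $B\mapsto q^{-2}B$. Define $A_L(v)=Av$, $B_L(v)=Bv$, $A_R(v)=vA$, $B_R(v)=vB$ for $v\in\mathbb V$. Put $\langle A,A\rangle=\langle B,B\rangle=2$, $\langle A,B\rangle=\langle B,A\rangle=-2$. The $q$-shuffle product $\star$ on $\mathbb V$ satisfies $1\star v=v\star1=v$ and, for $X\in\{A,B\}$ and a nontrivial word $v=v_1\cdots v_n$, $X\star v=\sum_{i=0}^n v_1\cdots v_iXv_{i+1}\cdots v_n\,q^{\langle v_1,X\rangle+\cdots+\langle v_i,X\rangle}$ and $v\star X=\sum_{i=0}^n v_1\cdots v_iXv_{i+1}\cdots v_n\,q^{\langle v_n,X\rangle+\langle v_{n-1},X\rangle+\cdots+\langle v_{i+1},X\rangle}$.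 Define $A_\ell(v)=A\star v$, $B_\ell(v)=B\star v$, $A_r(v)=v\star A$, $B_r(v)=v\star B$ for $v\in\mathbb V$. $J$ is the 2-sided ideal of the free algebra $\mathbb V$ generated by $A^3B-[3]_qA^2BA+[3]_qABA^2-BA^3$ and $B^3A-[3]_qB^2AB+[3]_qBAB^2-AB^3$; $\mathbb V/J$ is the quotient algebra. $J$ is invariant under $K^{\pm1},A_L,B_L,A_R,B_R,A^*_\ell,B^*_\ell,A^*_r,B^*_r$, so these maps act on $\mathbb V/J$ (with the same notation); in particular $K$ induces an automorphism of the algebra $\mathbb V/J$, also denoted $K$. The $\square_q$-module structures on $\mathbb V/J$ are as follows ($x_0,x_1,x_2,x_3$ act respectively as the listed maps). I: $A_L,\ Q(A^*_\ell-B^*_rK),\ B_L,\ Q(B^*_\ell-A^*_rK^{-1})$. IS: $A_R,\ Q(A^*_r-B^*_\ell K),\ B_R,\ Q(B^*_r-A^*_\ell K^{-1})$. IT: $B_L,\ Q(B^*_\ell-A^*_rK^{-1}),\ A_L,\ Q(A^*_\ell-B^*_rK)$. IST: $B_R,\ Q(B^*_r-A^*_\ell K^{-1}),\ A_R,\ Q(A^*_r-B^*_\ell K)$. II: $Q(A_L-KB_R),\ A^*_\ell,\ Q(B_L-K^{-1}A_R),\ B^*_\ell$. IIS: $Q(A_R-KB_L),\ A^*_r,\ Q(B_R-K^{-1}A_L),\ B^*_r$. IIT: $Q(B_L-K^{-1}A_R),\ B^*_\ell,\ Q(A_L-KB_R),\ A^*_\ell$. IIST: $Q(B_R-K^{-1}A_L),\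 B^*_r,\ Q(A_R-KB_L),\ A^*_r$. *)

theory Defs
  imports
    "HOL-Library.Poly_Mapping"
    "HOL-Library.Numeral_Type"
    "HOL-Algebra.QuotRing"
    "HOL-Algebra.Module"
begin

section \<open>Free algebras and quotient algebras\<close>

text \<open>The words in the generators \<open>'g\<close> form the free monoid, written additively so that
  finitely supported functions on words carry the convolution product of \<open>Poly_Mapping\<close>,
  that is, form the free algebra.\<close>

datatype 'g word = Word (letters: "'g list")

instantiation word :: (type) monoid_add
begin

definition zero_word :: "'a word" where
  "zero_word = Word []"

definition plus_word :: "'a word \<Rightarrow> 'a word \<Rightarrow> 'a word" where
  "plus_word u v = Word (letters u @ letters v)"

instance
  by standard (simp_all add: zero_word_def plus_word_def)

end

type_synonym ('g, 'f) free = "'g word \<Rightarrow>\<^sub>0 'f"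

definition scale :: "'f::field \<Rightarrow> ('g, 'f) free \<Rightarrow> ('g, 'f) free" where
  "scale c p = Poly_Mapping.map ((*) c) p"

definition word :: "'g list \<Rightarrow> ('g, 'f::field) free" where
  "word w = Poly_Mapping.single (Word w) 1"

definition gen :: "'g \<Rightarrow> ('g, 'f::field) free" where
  "gen x = word [x]"

definition lin_ext :: "('g list \<Rightarrow> ('h, 'f::field) free) \<Rightarrow> ('g, 'f) free \<Rightarrow> ('h, 'f) free" where
  "lin_ext f p = (\<Sum>w\<in>Poly_Mapping.keys p. scale (Poly_Mapping.lookup p w) (f (letters w)))"

definition alg_ext :: "('g \<Rightarrow> ('h, 'f::field) free) \<Rightarrow> ('g, 'f) free \<Rightarrow> ('h, 'f) free" where
  "alg_ext f = lin_ext (\<lambda>w. prod_list (map f w))"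

text \<open>Algebras over the field type \<open>'f\<close>, commutative or not, are represented by the record
  type \<open>module\<close> of HOL-Algebra, which has both a product and a scalar multiplication.\<close>

definition free_alg :: "('f::field, ('g, 'f) free) module" where
  "free_alg = \<lparr>carrier = UNIV, mult = (*), one = 1, zero = 0, add = (+), smult = scale\<rparr>"

definition quot_alg :: "('f, 'v) module \<Rightarrow> 'v set \<Rightarrow> ('f, 'v set) module" where
  "quot_alg A I = ring.extend (A Quot I)
     (module.fields (\<lambda>c X. \<Union>x\<in>X. I +>\<^bsub>A\<^esub> (c \<odot>\<^bsub>A\<^esub> x)))"

text \<open>The map that a linear map preserving the subspace \<open>I\<close> induces on cosets of \<open>I\<close>.\<close>

definition induced :: "('f, 'v) module \<Rightarrow> 'v set \<Rightarrow> ('v \<Rightarrow> 'v) \<Rightarrow> 'v set \<Rightarrow> 'v set" where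
  "induced A I f X = (\<Union>x\<in>X. I +>\<^bsub>A\<^esub> f x)"

definition lin_map :: "('f, 'v) module \<Rightarrow> ('v \<Rightarrow> 'v) \<Rightarrow> bool" where
  "lin_map M f \<longleftrightarrow>
     (\<forall>u\<in>carrier M. f u \<in> carrier M) \<and>
     (\<forall>u\<in>carrier M. \<forall>v\<in>carrier M. f (u \<oplus>\<^bsub>M\<^esub> v) = f u \<oplus>\<^bsub>M\<^esub> f v) \<and>
     (\<forall>c. \<forall>u\<in>carrier M. f (c \<odot>\<^bsub>M\<^esub> u) = c \<odot>\<^bsub>M\<^esub> f u)"

definition alg_automorphism :: "('f, 'v) module \<Rightarrow> ('v \<Rightarrow> 'v) \<Rightarrow> bool" where
  "alg_automorphism A \<phi> \<longleftrightarrow>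
     lin_map A \<phi> \<and> \<phi> \<in> ring_hom A A \<and> bij_betw \<phi> (carrier A) (carrier A)"

definition twisted_derivation ::
    "('f, 'v) module \<Rightarrow> ('v \<Rightarrow> 'v) \<Rightarrow> ('v \<Rightarrow> 'v) \<Rightarrow> ('v \<Rightarrow> 'v) \<Rightarrow> bool" where
  "twisted_derivation A \<phi> \<psi> \<delta> \<longleftrightarrow>
     alg_automorphism A \<phi> \<and> alg_automorphism A \<psi> \<and> lin_map A \<delta> \<and>
     (\<forall>u\<in>carrier A. \<forall>v\<in>carrier A.
        \<delta> (u \<otimes>\<^bsub>A\<^esub> v) = (\<phi> u \<otimes>\<^bsub>A\<^esub> \<delta> v) \<oplus>\<^bsub>A\<^esub> (\<delta> u \<otimes>\<^bsub>A\<^esub> \<psi> v))"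

text \<open>\<open>\<rho>\<close> makes the vector space \<open>M\<close> a left module over the algebra \<open>A\<close>; the product of \<open>M\<close>
  plays no role.\<close>

definition alg_module_structure ::
    "('f, 'a) module \<Rightarrow> ('f, 'v) module \<Rightarrow> ('a \<Rightarrow> 'v \<Rightarrow> 'v) \<Rightarrow> bool" where
  "alg_module_structure A M \<rho> \<longleftrightarrow>
     (\<forall>a\<in>carrier A. lin_map M (\<rho> a)) \<and>
     (\<forall>v\<in>carrier M.
        \<rho> \<one>\<^bsub>A\<^esub> v = v \<and>
        (\<forall>a\<in>carrier A. \<forall>b\<in>carrier A.
           \<rho> (a \<oplus>\<^bsub>A\<^esub> b) v = \<rho> a v \<oplus>\<^bsub>M\<^esub> \<rho> b v \<and>
           \<rho> (a \<otimes>\<^bsub>A\<^esub> b) v = \<rho> a (\<rho> b v)) \<and>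
        (\<forall>c. \<forall>a\<in>carrier A. \<rho> (c \<odot>\<^bsub>A\<^esub> a) v = c \<odot>\<^bsub>M\<^esub> \<rho> a v))"

definition serre :: "'f::field \<Rightarrow> ('g, 'f) free \<Rightarrow> ('g, 'f) free \<Rightarrow> ('g, 'f) free" where
  "serre q x y =
     (let three = (q ^ 3 - inverse q ^ 3) / (q - inverse q)
      in x ^ 3 * y - scale three (x ^ 2 * y * x) + scale three (x * y * x ^ 2) - y * x ^ 3)"

section \<open>The algebra \<open>\<box>\<^sub>q\<close>\<close>

text \<open>The numeral type \<open>4\<close> is the ring of integers modulo 4, so \<open>i + 1\<close> and \<open>i + 2\<close> below
  wrap around.\<close>

definition box_ideal :: "'f::field \<Rightarrow> (4, 'f) free set" where
  "box_ideal q = Idl\<^bsub>free_alg\<^esub>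
     (range (\<lambda>i. scale (1 / (q - inverse q))
         (scale q (gen i * gen (i + 1)) - scale (inverse q) (gen (i + 1) * gen i)) - 1)
      \<union> range (\<lambda>i. serre q (gen i) (gen (i + 2))))"

definition box_alg :: "'f::field \<Rightarrow> ('f, (4, 'f) free set) module" where
  "box_alg q = quot_alg free_alg (box_ideal q)"

definition box_gen :: "'f::field \<Rightarrow> 4 \<Rightarrow> (4, 'f) free set" where
  "box_gen q i = box_ideal q +>\<^bsub>free_alg\<^esub> gen i"

section \<open>The free algebra \<open>\<bbbV>\<close> and its operators\<close>

datatype letter = letA | letB

type_synonym 'f V = "(letter, 'f) free"

definition form :: "'f::field V \<Rightarrow> 'f V \<Rightarrow> 'f" where
  "form u v = (\<Sum>w\<in>Poly_Mapping.keys u. Poly_Mapping.lookup u w * Poly_Mapping.lookup v w)"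

text \<open>Row \<open>w\<close> of the matrix of \<open>X\<close> has the entries \<open>form (word w) (X (word w'))\<close>, with \<open>w'\<close>
  indexing the columns.\<close>

definition End_V :: "('f::field V \<Rightarrow> 'f V) set" where
  "End_V = {X. lin_map free_alg X \<and> (\<forall>w. finite {w'. form (word w) (X (word w')) \<noteq> 0})}"

definition adjoint :: "('f::field V \<Rightarrow> 'f V) \<Rightarrow> 'f V \<Rightarrow> 'f V" where
  "adjoint X = (THE Y. Y \<in> End_V \<and> (\<forall>u v. form (X u) v = form u (Y v)))"

definition K :: "'f::field \<Rightarrow> 'f V \<Rightarrow> 'f V" where
  "K q = alg_ext (\<lambda>x. case x of letA \<Rightarrow> scale (q ^ 2) (gen letA)
                              | letB \<Rightarrow> scale (inverse q ^ 2) (gen letB))"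

definition K_inv :: "'f::field \<Rightarrow> 'f V \<Rightarrow> 'f V" where
  "K_inv q = inv_into UNIV (K q)"

definition mult_L :: "letter \<Rightarrow> 'f::field V \<Rightarrow> 'f V" where
  "mult_L x v = gen x * v"

definition mult_R :: "letter \<Rightarrow> 'f::field V \<Rightarrow> 'f V" where
  "mult_R x v = v * gen x"

definition pairing :: "letter \<Rightarrow> letter \<Rightarrow> int" where
  "pairing x y = (if x = y then 2 else -2)"

text \<open>The maps \<open>v \<mapsto> x \<star> v\<close> and \<open>v \<mapsto> v \<star> x\<close> for a letter \<open>x\<close>. Only \<open>q\<close>-shuffle products with a
  letter are needed; for the empty word the sums reduce to \<open>x\<close>.\<close>

definition shuffle_l :: "'f::field \<Rightarrow> letter \<Rightarrow> 'f V \<Rightarrow> 'f V" where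
  "shuffle_l q x = lin_ext (\<lambda>v. \<Sum>i\<le>length v.
     scale (q powi (\<Sum>y\<leftarrow>take i v. pairing y x)) (word (take i v @ x # drop i v)))"

definition shuffle_r :: "'f::field \<Rightarrow> letter \<Rightarrow> 'f V \<Rightarrow> 'f V" where
  "shuffle_r q x = lin_ext (\<lambda>v. \<Sum>i\<le>length v.
     scale (q powi (\<Sum>y\<leftarrow>drop i v. pairing y x)) (word (take i v @ x # drop i v)))"

section \<open>The quotient \<open>\<bbbV>/J\<close> and the eight module structures\<close>

definition J :: "'f::field \<Rightarrow> 'f V set" where
  "J q = Idl\<^bsub>free_alg\<^esub> {serre q (gen letA) (gen letB), serre q (gen letB) (gen letA)}"

definition VJ :: "'f::field \<Rightarrow> ('f, 'f V set) module" where
  "VJ q = quot_alg free_alg (J q)"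

definition on_VJ :: "'f::field \<Rightarrow> ('f V \<Rightarrow> 'f V) \<Rightarrow> 'f V set \<Rightarrow> 'f V set" where
  "on_VJ q = induced free_alg (J q)"

datatype box_type =
  Type_I | Type_IS | Type_IT | Type_IST | Type_II | Type_IIS | Type_IIT | Type_IIST

text \<open>The operator on \<open>\<bbbV>\<close> inducing the action of \<open>x\<^sub>i\<close> on \<open>\<bbbV>/J\<close>.\<close>

definition box_op :: "'f::field \<Rightarrow> box_type \<Rightarrow> 4 \<Rightarrow> 'f V \<Rightarrow> 'f V" where
  "box_op q T i =
    (let Q = 1 - q ^ 2;
         Al = adjoint (shuffle_l q letA); Bl = adjoint (shuffle_l q letB);
         Ar = adjoint (shuffle_r q letA); Br = adjoint (shuffle_r q letB);
         AL = mult_L letA; BL = mult_L letB; AR = mult_R letA; BR = mult_R letB;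
         pick = (\<lambda>f0 f1 f2 f3. if i = 0 then f0 else if i = 1 then f1 else if i = 2 then f2 else f3)
     in case T of
       Type_I \<Rightarrow> pick
         AL (\<lambda>v. scale Q (Al v - Br (K q v))) BL (\<lambda>v. scale Q (Bl v - Ar (K_inv q v)))
     | Type_IS \<Rightarrow> pick
         AR (\<lambda>v. scale Q (Ar v - Bl (K q v))) BR (\<lambda>v. scale Q (Br v - Al (K_inv q v)))
     | Type_IT \<Rightarrow> pick
         BL (\<lambda>v. scale Q (Bl v - Ar (K_inv q v))) AL (\<lambda>v. scale Q (Al v - Br (K q v)))
     | Type_IST \<Rightarrow> pick
         BR (\<lambda>v. scale Q (Br v - Al (K_inv q v))) AR (\<lambda>v. scale Q (Ar v - Bl (K q v)))
     | Type_II \<Rightarrow> pick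
         (\<lambda>v. scale Q (AL v - K q (BR v))) Al (\<lambda>v. scale Q (BL v - K_inv q (AR v))) Bl
     | Type_IIS \<Rightarrow> pick
         (\<lambda>v. scale Q (AR v - K q (BL v))) Ar (\<lambda>v. scale Q (BR v - K_inv q (AL v))) Br
     | Type_IIT \<Rightarrow> pick
         (\<lambda>v. scale Q (BL v - K_inv q (AR v))) Bl (\<lambda>v. scale Q (AL v - K q (BR v))) Al
     | Type_IIST \<Rightarrow> pick
         (\<lambda>v. scale Q (BR v - K_inv q (AL v))) Br (\<lambda>v. scale Q (AR v - K q (BL v))) Ar)"

definition box_structure ::
    "'f::field \<Rightarrow> box_type \<Rightarrow> ((4, 'f) free set \<Rightarrow> 'f V set \<Rightarrow> 'f V set) \<Rightarrow> bool" where
  "box_structure q T \<rho> \<longleftrightarrow>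
     alg_module_structure (box_alg q) (VJ q) \<rho> \<and>
     (\<forall>i. \<forall>X\<in>carrier (VJ q). \<rho> (box_gen q i) X = on_VJ q (box_op q T i) X)"

text \<open>In the structure of type \<open>T\<close> the element \<open>x\<^sub>i\<close> acts as a \<open>(\<phi>, \<psi>)\<close>-derivation. The first
  conjunct states this for the prescribed action of the generator itself, so that the
  notion does not become vacuous when no \<open>\<rho>\<close> exists.\<close>

definition acts_as_derivation ::
    "'f::field \<Rightarrow> box_type \<Rightarrow> 4 \<Rightarrow> ('f V set \<Rightarrow> 'f V set) \<Rightarrow> ('f V set \<Rightarrow> 'f V set) \<Rightarrow> bool" where
  "acts_as_derivation q T i \<phi> \<psi> \<longleftrightarrow>
     twisted_derivation (VJ q) \<phi> \<psi> (on_VJ q (box_op q T i)) \<and>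
     (\<forall>\<rho>. box_structure q T \<rho> \<longrightarrow> twisted_derivation (VJ q) \<phi> \<psi> (\<rho> (box_gen q i)))"

end

theory Submission
  imports Defs
begin

text \<open>The adjoints of the \<open>q\<close>-shuffle multiplications by a letter \<open>x\<close> delete the occurrences
  of \<open>x\<close> in a word one at a time, each weighted by the letters to its left (for \<open>x \<star> v\<close>) or to
  its right (for \<open>v \<star> x\<close>). On a product \<open>u v\<close> the deletion happens in \<open>u\<close> or in \<open>v\<close>, and the
  factor contributed by the untouched part is the eigenvalue of \<open>K\<close> or of its inverse; so the
  adjoints are twisted derivations of the free algebra. They kill both \<open>q\<close>-Serre elements and
  therefore descend to \<open>\<bbbV>/J\<close>, as do their combinations with powers of \<open>K\<close>.\<close>

section \<open>Free algebras\<close>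

text \<open>The empty word is the unit of the monoid of words, so scalars sit inside the algebra as
  constants. Ring laws and ideal closure thereby apply to \<open>scale\<close>.\<close>

lemma scale_conv_mult: "scale c p = Poly_Mapping.single 0 c * p"
  by (simp add: scale_def mult_map_scale_conv_mult)

lemma lookup_scale [simp]: "Poly_Mapping.lookup (scale c p) w = c * Poly_Mapping.lookup p w"
  by (simp add: scale_def map.rep_eq when_def)

lemma scale_add_right: "scale c (p + r) = scale c p + scale c r"
  by (rule poly_mapping_eqI) (simp add: lookup_add algebra_simps)

lemma scale_add_left: "scale (c + d) p = scale c p + scale d p"
  by (rule poly_mapping_eqI) (simp add: lookup_add algebra_simps)

lemma scale_diff_right: "scale c (p - r) = scale c p - scale c r"
  by (rule poly_mapping_eqI) (simp add: lookup_minus algebra_simps)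

lemma scale_scale [simp]: "scale c (scale d p) = scale (c * d) p"
  by (rule poly_mapping_eqI) (simp add: algebra_simps)

lemma scale_one [simp]: "scale 1 p = p"
  by (rule poly_mapping_eqI) simp

lemma scale_zero_left [simp]: "scale 0 p = 0"
  by (rule poly_mapping_eqI) simp

lemma scale_zero_right [simp]: "scale c 0 = 0"
  by (rule poly_mapping_eqI) simp

lemma scale_sum: "scale c (sum f S) = (\<Sum>i\<in>S. scale c (f i))"
  by (induction S rule: infinite_finite_induct) (simp_all add: scale_add_right)

lemma scale_mult_left [simp]: "scale c p * r = scale c (p * r)"
  by (simp add: scale_conv_mult mult.assoc)

lemma word_mult: "word u * word v = word (u @ v)"
  by (simp add: word_def mult_single plus_word_def)

lemma gen_mult_word: "gen x * word w = word (x # w)"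
  by (simp add: gen_def word_mult)

lemma one_eq_word: "1 = word []"
  by (simp add: word_def zero_word_def flip: single_one)

lemma lookup_word: "Poly_Mapping.lookup (word u) w = (if w = Word u then 1 else 0)"
  by (auto simp: word_def lookup_single when_def)

lemma free_expand:
  "p = (\<Sum>w\<in>Poly_Mapping.keys p. scale (Poly_Mapping.lookup p w) (word (letters w)))"
  by (rule poly_mapping_eqI)
    (auto simp: lookup_sum lookup_word if_distrib in_keys_iff cong: if_cong)

text \<open>Words span the free algebra. The zero element needs no separate case, being a word
  scaled by 0.\<close>

lemma free_induct [case_names word add scale]:
  assumes "\<And>w. P (word w)"
    and "\<And>p r. P p \<Longrightarrow> P r \<Longrightarrow> P (p + r)"
    and "\<And>c p. P p \<Longrightarrow> P (scale c p)"
  shows "P p"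
proof -
  have "P (\<Sum>w\<in>S. scale (f w) (word (letters w)))" for S :: "'a word set" and f
  proof (induction S rule: infinite_finite_induct)
    case (insert x F)
    then show ?case using assms by simp
  qed (use assms(3)[OF assms(1), of 0] in simp_all)
  then show ?thesis by (subst free_expand)
qed

text \<open>Together with \<open>scale_conv_mult\<close> this makes constants central, so scalars
  can be pulled out of a right factor.\<close>

lemma mult_single_zero: "p * Poly_Mapping.single 0 c = scale c p"
proof (induction p rule: free_induct)
  case (word w)
  then show ?case
    by (simp add: word_def scale_conv_mult mult_single)
qed (simp_all add: algebra_simps scale_add_right)

lemma scale_mult_right [simp]: "p * scale c r = scale c (p * r)"
  by (simp add: scale_conv_mult[of c r] mult_single_zero flip: mult.assoc)

text \<open>Cancellation can shrink the support of a sum. Summing over a fixed finite superset,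
  where the extra terms vanish, lets two linear combinations be compared termwise.\<close>

lemma lin_ext_superset:
  assumes "finite S" "Poly_Mapping.keys p \<subseteq> S"
  shows "lin_ext f p = (\<Sum>w\<in>S. scale (Poly_Mapping.lookup p w) (f (letters w)))"
  unfolding lin_ext_def using assms
  by (intro sum.mono_neutral_left) (auto simp: in_keys_iff)

lemma lin_ext_add: "lin_ext f (p + r) = lin_ext f p + lin_ext f r"
proof -
  let ?S = "Poly_Mapping.keys p \<union> Poly_Mapping.keys r"
  have "Poly_Mapping.keys (p + r) \<subseteq> ?S"
    by (rule keys_add)
  then show ?thesis
    by (simp add: lin_ext_superset[of ?S] lookup_add scale_add_left sum.distrib)
qed

lemma lin_ext_scale: "lin_ext f (scale c p) = scale c (lin_ext f p)"
proof -
  have "Poly_Mapping.keys (scale c p) \<subseteq> Poly_Mapping.keys p"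
    by (auto simp: in_keys_iff)
  then show ?thesis
    by (simp add: lin_ext_superset[of "Poly_Mapping.keys p"] scale_sum)
qed

lemma lin_ext_word [simp]: "lin_ext f (word w) = f w"
  by (simp add: lin_ext_def word_def)

section \<open>The free algebra as a ring with ideals\<close>

lemma free_alg_simps [simp]:
  "carrier free_alg = UNIV" "mult free_alg = (*)" "one free_alg = 1"
  "zero free_alg = 0" "add free_alg = (+)" "smult free_alg = scale"
  by (simp_all add: free_alg_def)

lemma lin_map_free_iff:
  "lin_map free_alg f \<longleftrightarrow>
     (\<forall>u v. f (u + v) = f u + f v) \<and> (\<forall>c u. f (scale c u) = scale c (f u))"
  by (simp add: lin_map_def)

lemma lin_map_lin_ext: "lin_map free_alg (lin_ext f)"
  by (simp add: lin_map_free_iff lin_ext_add lin_ext_scale)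

lemma lin_map_id: "lin_map M id"
  by (simp add: lin_map_def)

lemma lin_map_comp: "lin_map M f \<Longrightarrow> lin_map M g \<Longrightarrow> lin_map M (f \<circ> g)"
  by (simp add: lin_map_def)

lemma lin_map_zero: "lin_map free_alg f \<Longrightarrow> f 0 = 0"
  by (metis lin_map_free_iff scale_zero_left)

lemma lin_map_diff: "lin_map free_alg f \<Longrightarrow> f (u - v) = f u - f v"
  by (metis lin_map_free_iff add_diff_cancel diff_add_cancel)

lemma lin_map_eqI:
  assumes "lin_map free_alg f" "lin_map free_alg g" "\<And>w. f (word w) = g (word w)"
  shows "f = g"
proof
  show "f p = g p" for p
    using assms by (induction p rule: free_induct) (simp_all add: lin_map_free_iff)
qed

lemma ring_free_alg: "ring (free_alg :: ('f::field, ('g, 'f) free) module)"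
proof (rule ringI)
  show "abelian_group (free_alg :: ('f, ('g, 'f) free) module)"
  proof (rule abelian_groupI)
    show "\<exists>y\<in>carrier free_alg. y \<oplus>\<^bsub>free_alg\<^esub> x = \<zero>\<^bsub>free_alg\<^esub>" for x :: "('g, 'f) free"
      by (rule bexI[of _ "- x"]) simp_all
  qed (simp_all add: algebra_simps)
  show "Group.monoid (free_alg :: ('f, ('g, 'f) free) module)"
    by (rule monoidI) (simp_all add: mult.assoc)
qed (simp_all add: algebra_simps)

text \<open>Closure under negation comes from multiplying by -1.\<close>

lemma ideal_free_algI:
  assumes "0 \<in> I" "\<And>a b. a \<in> I \<Longrightarrow> b \<in> I \<Longrightarrow> a + b \<in> I"
    and "\<And>a b. a \<in> I \<Longrightarrow> b * a \<in> I" "\<And>a b. a \<in> I \<Longrightarrow> a * b \<in> I"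
  shows "ideal I free_alg"
proof (rule idealI[OF ring_free_alg])
  show "subgroup I (add_monoid free_alg)"
  proof (rule group.subgroupI)
    show "Group.group (add_monoid free_alg)"
      using ring.is_abelian_group[OF ring_free_alg] by (rule abelian_group.a_group)
    show "inv\<^bsub>add_monoid free_alg\<^esub> a \<in> I" if "a \<in> I" for a
    proof -
      have "\<ominus>\<^bsub>free_alg\<^esub> a = - a"
        using abelian_group.minus_equality[OF ring.is_abelian_group[OF ring_free_alg], of "- a" a]
        by simp
      then show ?thesis
        using assms(3)[OF that, of "- 1"] by (simp add: a_inv_def)
    qed
  qed (use assms in auto)
qed (use assms in auto)

section \<open>Twisted derivations of quotient algebras\<close>

lemma coset_def: "I +>\<^bsub>free_alg\<^esub> a = (\<lambda>h. h + a) ` I"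
  by (auto simp: a_r_coset_def r_coset_def)

context
  fixes I :: "('g, 'f::field) free set"
  assumes ideal_I: "ideal I free_alg"
begin

lemma ideal_zero: "0 \<in> I"
  using additive_subgroup.zero_closed[OF ideal.axioms(1)[OF ideal_I]] by simp

lemma ideal_add: "a \<in> I \<Longrightarrow> b \<in> I \<Longrightarrow> a + b \<in> I"
  using additive_subgroup.a_closed[OF ideal.axioms(1)[OF ideal_I]] by simp

lemma ideal_mult_left: "a \<in> I \<Longrightarrow> b * a \<in> I"
  using ideal.I_l_closed[OF ideal_I] by simp

lemma ideal_mult_right: "a \<in> I \<Longrightarrow> a * b \<in> I"
  using ideal.I_r_closed[OF ideal_I] by simp

lemma ideal_scale: "a \<in> I \<Longrightarrow> scale c a \<in> I"
  by (simp add: scale_conv_mult ideal_mult_left)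

lemma ideal_uminus: "a \<in> I \<Longrightarrow> - a \<in> I"
  using ideal_mult_left[of a "- 1"] by simp

lemma ideal_diff: "a \<in> I \<Longrightarrow> b \<in> I \<Longrightarrow> a - b \<in> I"
  using ideal_add[of a "- b"] ideal_uminus by simp

lemma mem_coset_iff: "x \<in> I +>\<^bsub>free_alg\<^esub> a \<longleftrightarrow> x - a \<in> I"
  unfolding coset_def by (auto simp: image_iff) (metis diff_add_cancel)

lemma coset_eq_iff: "I +>\<^bsub>free_alg\<^esub> a = I +>\<^bsub>free_alg\<^esub> b \<longleftrightarrow> a - b \<in> I"
proof
  assume "I +>\<^bsub>free_alg\<^esub> a = I +>\<^bsub>free_alg\<^esub> b"
  moreover have "a \<in> I +>\<^bsub>free_alg\<^esub> a"
    by (simp add: mem_coset_iff ideal_zero)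
  ultimately show "a - b \<in> I"
    by (simp add: mem_coset_iff)
next
  assume ab: "a - b \<in> I"
  have "x - a \<in> I \<longleftrightarrow> x - b \<in> I" for x
    using ideal_add[of "x - a" "a - b"] ideal_diff[of "x - b" "a - b"] ab by auto
  then show "I +>\<^bsub>free_alg\<^esub> a = I +>\<^bsub>free_alg\<^esub> b"
    by (auto simp: mem_coset_iff)
qed

text \<open>Members of one coset differ by elements of \<open>I\<close>, and \<open>f\<close> maps
  these into \<open>I\<close>. All cosets in the union therefore coincide; this evaluates both
  \<open>induced\<close> and the scalar multiplication of \<open>quot_alg\<close> on
  representatives.\<close>

lemma UN_coset:
  assumes "lin_map free_alg f" "f ` I \<subseteq> I"
  shows "(\<Union>x\<in>I +>\<^bsub>free_alg\<^esub> a. I +>\<^bsub>free_alg\<^esub> f x) = I +>\<^bsub>free_alg\<^esub> f a"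
proof -
  have "I +>\<^bsub>free_alg\<^esub> f x = I +>\<^bsub>free_alg\<^esub> f a" if "x \<in> I +>\<^bsub>free_alg\<^esub> a" for x
    using that assms by (auto simp: coset_eq_iff mem_coset_iff simp flip: lin_map_diff[OF assms(1)])
  moreover have "a \<in> I +>\<^bsub>free_alg\<^esub> a"
    by (simp add: mem_coset_iff ideal_zero)
  ultimately show ?thesis by blast
qed

lemma induced_coset:
  assumes "lin_map free_alg f" "f ` I \<subseteq> I"
  shows "induced free_alg I f (I +>\<^bsub>free_alg\<^esub> a) = I +>\<^bsub>free_alg\<^esub> f a"
  using UN_coset[OF assms] by (simp add: induced_def)

lemma carrier_quot: "carrier (quot_alg free_alg I) = range (\<lambda>a. I +>\<^bsub>free_alg\<^esub> a)"
  by (auto simp: quot_alg_def ring.defs module.defs FactRing_def A_RCOSETS_def')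

lemma quot_mult:
  "(I +>\<^bsub>free_alg\<^esub> a) \<otimes>\<^bsub>quot_alg free_alg I\<^esub> (I +>\<^bsub>free_alg\<^esub> b) = I +>\<^bsub>free_alg\<^esub> (a * b)"
  using ideal.rcoset_mult_add[OF ideal_I, of a b]
  by (simp add: quot_alg_def ring.defs module.defs FactRing_def)

lemma quot_add:
  "(I +>\<^bsub>free_alg\<^esub> a) \<oplus>\<^bsub>quot_alg free_alg I\<^esub> (I +>\<^bsub>free_alg\<^esub> b) = I +>\<^bsub>free_alg\<^esub> (a + b)"
  using abelian_subgroup.a_rcos_sum[OF abelian_subgroupI3[OF ideal.axioms(1)[OF ideal_I]
      ring.is_abelian_group[OF ring_free_alg]], of a b]
  by (simp add: quot_alg_def ring.defs module.defs FactRing_def)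

lemma quot_one: "\<one>\<^bsub>quot_alg free_alg I\<^esub> = I +>\<^bsub>free_alg\<^esub> 1"
  by (simp add: quot_alg_def ring.defs module.defs FactRing_def)

lemma quot_smult:
  "c \<odot>\<^bsub>quot_alg free_alg I\<^esub> (I +>\<^bsub>free_alg\<^esub> a) = I +>\<^bsub>free_alg\<^esub> scale c a"
proof -
  have "lin_map free_alg (scale c :: ('g, 'f) free \<Rightarrow> _)" "scale c ` I \<subseteq> I"
    by (auto simp: lin_map_free_iff scale_add_right mult.commute ideal_scale)
  then show ?thesis
    by (simp add: UN_coset quot_alg_def ring.defs module.defs)
qed

lemmas quot_simps = quot_mult quot_add quot_one quot_smult

lemma lin_map_induced:
  assumes "lin_map free_alg f" "f ` I \<subseteq> I"
  shows "lin_map (quot_alg free_alg I) (induced free_alg I f)"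
  using assms
  by (auto simp: lin_map_def[of "quot_alg free_alg I"] carrier_quot induced_coset quot_simps)
    (simp_all add: lin_map_free_iff)

lemma alg_automorphism_induced:
  assumes "alg_automorphism free_alg \<phi>" "\<phi> ` I = I"
  shows "alg_automorphism (quot_alg free_alg I) (induced free_alg I \<phi>)"
proof -
  have lin: "lin_map free_alg \<phi>" and hom: "\<phi> \<in> ring_hom free_alg free_alg" and "bij \<phi>"
    using assms(1) by (auto simp: alg_automorphism_def)
  note ind = induced_coset[OF lin equalityD1[OF assms(2)]]
  have "induced free_alg I \<phi> \<in> ring_hom (quot_alg free_alg I) (quot_alg free_alg I)"
    using hom by (auto simp: ring_hom_def carrier_quot ind quot_simps)
  moreover have "inj_on (induced free_alg I \<phi>) (carrier (quot_alg free_alg I))"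
  proof (rule inj_onI, clarsimp simp: carrier_quot ind coset_eq_iff)
    fix a b
    assume "\<phi> a - \<phi> b \<in> I"
    then have "\<phi> (a - b) \<in> \<phi> ` I"
      by (simp add: lin_map_diff[OF lin] assms(2))
    then show "a - b \<in> I"
      using \<open>bij \<phi>\<close> by (auto simp: bij_def inj_def)
  qed
  moreover have "induced free_alg I \<phi> ` carrier (quot_alg free_alg I)
      = carrier (quot_alg free_alg I)"
    unfolding carrier_quot image_image ind
    using \<open>bij \<phi>\<close> by (metis bij_is_surj image_image)
  ultimately show ?thesis
    using lin_map_induced[OF lin equalityD1[OF assms(2)]]
    by (simp add: alg_automorphism_def bij_betw_def)
qed

lemma twisted_derivation_induced:
  assumes "twisted_derivation free_alg \<phi> \<psi> \<delta>" "\<phi> ` I = I" "\<psi> ` I = I" "\<delta> ` I \<subseteq> I"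
  shows "twisted_derivation (quot_alg free_alg I)
    (induced free_alg I \<phi>) (induced free_alg I \<psi>) (induced free_alg I \<delta>)"
proof -
  have "alg_automorphism free_alg \<phi>" "alg_automorphism free_alg \<psi>" "lin_map free_alg \<delta>"
    and rule: "\<And>u v. \<delta> (u * v) = \<phi> u * \<delta> v + \<delta> u * \<psi> v"
    using assms(1) by (auto simp: twisted_derivation_def)
  moreover from this have "lin_map free_alg \<phi>" "lin_map free_alg \<psi>"
    by (simp_all add: alg_automorphism_def)
  ultimately show ?thesis
    using assms(2-4)
    by (simp add: twisted_derivation_def alg_automorphism_induced lin_map_induced)
      (auto simp: carrier_quot induced_coset quot_simps rule)
qed

lemma induced_id: "X \<in> carrier (quot_alg free_alg I) \<Longrightarrow> induced free_alg I id X = X"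
  by (auto simp: carrier_quot induced_coset lin_map_id)

lemma alg_automorphism_quot_id: "alg_automorphism (quot_alg free_alg I) id"
  by (auto simp: alg_automorphism_def lin_map_id ring_hom_def carrier_quot quot_simps)

text \<open>Only values on cosets matter. This is used to replace the map induced by the identity
  with \<open>id\<close>, and a prescribed action with any \<open>\<rho>\<close> that agrees with it
  on the carrier.\<close>

lemma twisted_derivation_quot_cong:
  assumes "twisted_derivation (quot_alg free_alg I) \<phi>' \<psi>' \<delta>'"
    and "alg_automorphism (quot_alg free_alg I) \<phi>" "alg_automorphism (quot_alg free_alg I) \<psi>"
    and "\<And>X. X \<in> carrier (quot_alg free_alg I) \<Longrightarrow> \<phi>' X = \<phi> X"
    and "\<And>X. X \<in> carrier (quot_alg free_alg I) \<Longrightarrow> \<psi>' X = \<psi> X"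
    and "\<And>X. X \<in> carrier (quot_alg free_alg I) \<Longrightarrow> \<delta>' X = \<delta> X"
  shows "twisted_derivation (quot_alg free_alg I) \<phi> \<psi> \<delta>"
proof -
  have "X \<oplus>\<^bsub>quot_alg free_alg I\<^esub> Y \<in> carrier (quot_alg free_alg I)"
      "X \<otimes>\<^bsub>quot_alg free_alg I\<^esub> Y \<in> carrier (quot_alg free_alg I)"
      "c \<odot>\<^bsub>quot_alg free_alg I\<^esub> X \<in> carrier (quot_alg free_alg I)"
    if "X \<in> carrier (quot_alg free_alg I)" "Y \<in> carrier (quot_alg free_alg I)" for X Y c
    using that by (auto simp: carrier_quot quot_simps)
  then show ?thesis
    using assms by (simp add: twisted_derivation_def lin_map_def)
qed

end

lemma derivation_preserves_Idl:
  assumes "twisted_derivation free_alg \<phi> \<psi> \<delta>"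
    and "\<phi> ` (Idl\<^bsub>free_alg\<^esub> S) \<subseteq> Idl\<^bsub>free_alg\<^esub> S" "\<psi> ` (Idl\<^bsub>free_alg\<^esub> S) \<subseteq> Idl\<^bsub>free_alg\<^esub> S"
    and "\<delta> ` S \<subseteq> Idl\<^bsub>free_alg\<^esub> S"
  shows "\<delta> ` (Idl\<^bsub>free_alg\<^esub> S) \<subseteq> Idl\<^bsub>free_alg\<^esub> S"
proof -
  let ?I = "Idl\<^bsub>free_alg\<^esub> S"
  have I: "ideal ?I free_alg" and S: "S \<subseteq> ?I"
    using ring.genideal_ideal[OF ring_free_alg] ring.genideal_self[OF ring_free_alg] by auto
  have lin: "lin_map free_alg \<delta>" and rule: "\<And>u v. \<delta> (u * v) = \<phi> u * \<delta> v + \<delta> u * \<psi> v"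
    using assms(1) by (auto simp: twisted_derivation_def)
  have add: "\<delta> (u + v) = \<delta> u + \<delta> v" for u v
    using lin by (simp add: lin_map_free_iff)
  \<comment> \<open>The condition \<open>p \<in> ?I\<close> is kept in the set because the Leibniz
    rule also produces the terms \<open>\<phi> u * \<delta> v\<close> and
    \<open>\<delta> u * \<psi> v\<close>, which lie in the ideal when \<open>\<phi> u\<close> or
    \<open>\<psi> v\<close> does.\<close>
  have "ideal {p \<in> ?I. \<delta> p \<in> ?I} free_alg"
    using assms(2,3) lin_map_zero[OF lin]
    by (intro ideal_free_algI)
      (auto simp: rule add image_subset_iff ideal_zero[OF I]
        intro: ideal_mult_left[OF I] ideal_mult_right[OF I] ideal_add[OF I])
  then have "?I \<subseteq> {p \<in> ?I. \<delta> p \<in> ?I}"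
    using S assms(4) by (intro ring.genideal_minimal[OF ring_free_alg]) auto
  then show ?thesis by auto
qed

text \<open>Since \<open>\<alpha>\<close> is multiplicative, precomposition with it changes both
  twists. An (I, K^(-1))-derivation followed after K in this way becomes a (K,
  I)-derivation.\<close>

lemma derivation_comp:
  assumes "twisted_derivation M \<phi> \<psi> \<delta>" "alg_automorphism M \<alpha>"
    "alg_automorphism M (\<phi> \<circ> \<alpha>)" "alg_automorphism M (\<psi> \<circ> \<alpha>)"
  shows "twisted_derivation M (\<phi> \<circ> \<alpha>) (\<psi> \<circ> \<alpha>) (\<delta> \<circ> \<alpha>)"
  using assms
  by (auto simp: twisted_derivation_def alg_automorphism_def lin_map_comp ring_hom_def lin_map_def)

lemma derivation_scale_diff:
  assumes "twisted_derivation free_alg \<phi> \<psi> \<delta>" "twisted_derivation free_alg \<phi> \<psi> \<epsilon>"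
  shows "twisted_derivation free_alg \<phi> \<psi> (\<lambda>v. scale c (\<delta> v - \<epsilon> v))"
  using assms
  by (auto simp: twisted_derivation_def lin_map_free_iff scale_add_right scale_diff_right
      algebra_simps)

section \<open>Diagonal automorphisms and deletion of a letter\<close>

text \<open>The multiplicative character on words with prescribed values on letters; powers of q
  given by sums of pairings take this form.\<close>

definition weight :: "('g \<Rightarrow> 'f::field) \<Rightarrow> 'g list \<Rightarrow> 'f" where
  "weight \<phi> w = prod_list (map \<phi> w)"

lemma weight_simps [simp]:
  "weight \<phi> [] = 1" "weight \<phi> (x # w) = \<phi> x * weight \<phi> w"
  "weight \<phi> (v @ w) = weight \<phi> v * weight \<phi> w"
  by (simp_all add: weight_def)

lemma weight_one [simp]: "weight (\<lambda>_. 1) w = 1"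
  by (induction w) simp_all

lemma weight_mult: "weight (\<lambda>x. \<phi> x * \<psi> x) w = weight \<phi> w * weight \<psi> w"
  by (induction w) simp_all

definition diag :: "('g \<Rightarrow> 'f::field) \<Rightarrow> ('g, 'f) free \<Rightarrow> ('g, 'f) free" where
  "diag \<phi> = lin_ext (\<lambda>w. scale (weight \<phi> w) (word w))"

lemma lin_map_diag: "lin_map free_alg (diag \<phi>)"
  by (simp add: diag_def lin_map_lin_ext)

lemma diag_simps:
  "diag \<phi> (word w) = scale (weight \<phi> w) (word w)"
  "diag \<phi> (u + v) = diag \<phi> u + diag \<phi> v"
  "diag \<phi> (u - v) = diag \<phi> u - diag \<phi> v"
  "diag \<phi> (scale c u) = scale c (diag \<phi> u)"
  by (simp_all add: diag_def lin_ext_add lin_ext_scale lin_map_diff[OF lin_map_lin_ext])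

lemma diag_comp: "diag \<phi> \<circ> diag \<psi> = diag (\<lambda>x. \<phi> x * \<psi> x)"
  by (intro lin_map_eqI lin_map_comp lin_map_diag)
    (simp add: diag_simps weight_mult mult.commute)

lemma diag_one: "diag (\<lambda>_. 1) = id"
  by (intro lin_map_eqI lin_map_diag lin_map_id) (simp add: diag_simps)

text \<open>Both sides are bilinear, so nested induction reduces the claim to words, where
  \<open>weight\<close> is multiplicative.\<close>

lemma diag_mult: "diag \<phi> (p * r) = diag \<phi> p * diag \<phi> r"
proof (induction p rule: free_induct)
  case (word w)
  show ?case
    by (induction r rule: free_induct)
      (simp_all add: word_mult diag_simps algebra_simps scale_add_right)
qed (simp_all add: diag_simps algebra_simps)

lemma diag_inverse:
  assumes "\<And>x. \<phi> x \<noteq> 0"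
  shows "diag \<phi> \<circ> diag (\<lambda>x. inverse (\<phi> x)) = id" "diag (\<lambda>x. inverse (\<phi> x)) \<circ> diag \<phi> = id"
  using assms by (simp_all add: diag_comp diag_one)

lemma alg_automorphism_diag:
  assumes "\<And>x. \<phi> x \<noteq> 0"
  shows "alg_automorphism free_alg (diag \<phi>)"
proof -
  have "bij (diag \<phi>)"
    using diag_inverse[OF assms] by (intro o_bij)
  moreover have "diag \<phi> 1 = 1"
    by (simp add: one_eq_word diag_simps)
  ultimately show ?thesis
    by (simp add: alg_automorphism_def lin_map_diag ring_hom_def diag_mult diag_simps)
qed

text \<open>Letters to the left of the deleted \<open>x\<close> contribute \<open>\<phi>\<close>,
  those to its right \<open>\<psi>\<close>. One recursion thus serves both adjoints: take
  \<open>\<psi>\<close> constantly 1 for left shuffle multiplication and \<open>\<phi>\<close>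
  constantly 1 for right.\<close>

primrec del_word :: "('g \<Rightarrow> 'f::field) \<Rightarrow> ('g \<Rightarrow> 'f) \<Rightarrow> 'g \<Rightarrow> 'g list \<Rightarrow> ('g, 'f) free" where
  "del_word \<phi> \<psi> x [] = 0"
| "del_word \<phi> \<psi> x (y # w) =
     (if y = x then scale (weight \<psi> w) (word w) else 0) + scale (\<phi> y) (gen y * del_word \<phi> \<psi> x w)"

definition del :: "('g \<Rightarrow> 'f::field) \<Rightarrow> ('g \<Rightarrow> 'f) \<Rightarrow> 'g \<Rightarrow> ('g, 'f) free \<Rightarrow> ('g, 'f) free" where
  "del \<phi> \<psi> x = lin_ext (del_word \<phi> \<psi> x)"

lemma del_simps:
  "del \<phi> \<psi> x (word w) = del_word \<phi> \<psi> x w"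
  "del \<phi> \<psi> x (u + v) = del \<phi> \<psi> x u + del \<phi> \<psi> x v"
  "del \<phi> \<psi> x (u - v) = del \<phi> \<psi> x u - del \<phi> \<psi> x v"
  "del \<phi> \<psi> x (scale c u) = scale c (del \<phi> \<psi> x u)"
  by (simp_all add: del_def lin_ext_add lin_ext_scale lin_map_diff[OF lin_map_lin_ext])

lemma del_word_append:
  "del_word \<phi> \<psi> x (u @ v) =
     scale (weight \<phi> u) (word u * del_word \<phi> \<psi> x v) + scale (weight \<psi> v) (del_word \<phi> \<psi> x u * word v)"
proof (induction u)
  case Nil
  then show ?case by (simp flip: one_eq_word)
next
  case (Cons y u)
  then show ?case
    by (simp add: scale_add_right algebra_simps word_mult flip: gen_mult_word)
qed

lemma del_mult: "del \<phi> \<psi> x (p * r) = diag \<phi> p * del \<phi> \<psi> x r + del \<phi> \<psi> x p * diag \<psi> r"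
proof (induction p rule: free_induct)
  case (word w)
  show ?case
    by (induction r rule: free_induct)
      (simp_all add: word_mult diag_simps del_simps del_word_append algebra_simps scale_add_right)
qed (simp_all add: diag_simps del_simps scale_add_right algebra_simps)

lemma twisted_derivation_del:
  assumes "\<And>y. \<phi> y \<noteq> 0" "\<And>y. \<psi> y \<noteq> 0"
  shows "twisted_derivation free_alg (diag \<phi>) (diag \<psi>) (del \<phi> \<psi> x)"
  using assms
  by (simp add: twisted_derivation_def alg_automorphism_diag del_mult)
    (simp add: del_def lin_map_lin_ext)

section \<open>Insertion of a letter and adjoints\<close>

definition ins_word :: "('g \<Rightarrow> 'f::field) \<Rightarrow> ('g \<Rightarrow> 'f) \<Rightarrow> 'g \<Rightarrow> 'g list \<Rightarrow> ('g, 'f) free" where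
  "ins_word \<phi> \<psi> x v = (\<Sum>i\<le>length v.
     scale (weight \<phi> (take i v) * weight \<psi> (drop i v)) (word (take i v @ x # drop i v)))"

lemma ins_word_Nil: "ins_word \<phi> \<psi> x [] = word [x]"
  by (simp add: ins_word_def)

text \<open>The new letter goes either in front of \<open>y\<close> or somewhere after it. The
  resulting recursion mirrors that of \<open>del_word\<close>.\<close>

lemma ins_word_Cons:
  "ins_word \<phi> \<psi> x (y # w) =
     scale (weight \<psi> (y # w)) (word (x # y # w)) + scale (\<phi> y) (gen y * ins_word \<phi> \<psi> x w)"
  unfolding ins_word_def
  \<comment> \<open>The term split off is the one for \<open>i = 0\<close>, insertion at the front,
    rather than the last one.\<close>
  by (simp add: sum.atMost_Suc_shift scale_sum sum_distrib_left gen_mult_word mult.assoc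
      del: sum.atMost_Suc)

lemma lookup_gen_mult:
  "Poly_Mapping.lookup (gen y * p) (Word v) =
     (case v of [] \<Rightarrow> 0 | z # w \<Rightarrow> if y = z then Poly_Mapping.lookup p (Word w) else 0)"
  by (induction p rule: free_induct)
    (auto simp: gen_mult_word lookup_word lookup_add algebra_simps split: list.split)

text \<open>Insertion and deletion have transposed matrices: inserting \<open>x\<close> into
  \<open>u\<close> at a position yields \<open>v\<close> exactly when deleting that occurrence from
  \<open>v\<close> yields \<open>u\<close>, and the weights on either side agree. The induction
  compares first letters, hence the arbitrary \<open>u\<close>.\<close>

lemma lookup_ins_word:
  "Poly_Mapping.lookup (ins_word \<phi> \<psi> x u) (Word v) =
     Poly_Mapping.lookup (del_word \<phi> \<psi> x v) (Word u)"
proof (induction v arbitrary: u)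
  case Nil
  then show ?case
    by (cases u) (simp_all add: ins_word_Nil ins_word_Cons lookup_word lookup_add lookup_gen_mult)
next
  case (Cons z v)
  then show ?case
    by (cases u)
      (auto simp: ins_word_Nil ins_word_Cons lookup_word lookup_add lookup_gen_mult)
qed

section \<open>The bilinear form and adjoints\<close>

lemma form_superset:
  assumes "finite S" "Poly_Mapping.keys u \<subseteq> S"
  shows "form u v = (\<Sum>w\<in>S. Poly_Mapping.lookup u w * Poly_Mapping.lookup v w)"
  unfolding form_def using assms
  by (intro sum.mono_neutral_left) (auto simp: in_keys_iff)

lemma form_word_left: "form (word w) v = Poly_Mapping.lookup v (Word w)"
  by (simp add: form_def word_def)

lemma form_add_left: "form (u + u') v = form u v + form u' v"
proof -
  let ?S = "Poly_Mapping.keys u \<union> Poly_Mapping.keys u'"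
  have "Poly_Mapping.keys (u + u') \<subseteq> ?S"
    by (rule keys_add)
  then show ?thesis
    by (simp add: form_superset[of ?S] lookup_add algebra_simps sum.distrib)
qed

lemma form_scale_left: "form (scale c u) v = c * form u v"
proof -
  have "Poly_Mapping.keys (scale c u) \<subseteq> Poly_Mapping.keys u"
    by (auto simp: in_keys_iff)
  then show ?thesis
    by (simp add: form_superset[of "Poly_Mapping.keys u"] sum_distrib_left mult.assoc)
qed

lemma form_add_right: "form u (v + v') = form u v + form u v'"
  by (simp add: form_def lookup_add algebra_simps sum.distrib)

lemma form_scale_right: "form u (scale c v) = c * form u v"
  by (simp add: form_def sum_distrib_left algebra_simps)

lemma form_word_right: "form u (word w) = Poly_Mapping.lookup u (Word w)"
  by (induction u rule: free_induct)
    (auto simp: form_word_left lookup_word form_add_left form_scale_left lookup_add)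

text \<open>Transposed matrices on words give adjointness by bilinearity; uniqueness holds because
  pairing with words recovers all coefficients.\<close>

lemma adjoint_eqI:
  assumes X: "lin_map free_alg X" and Y: "lin_map free_alg Y"
    and XY: "\<And>u v. Poly_Mapping.lookup (X (word u)) (Word v) = Poly_Mapping.lookup (Y (word v)) (Word u)"
  shows "adjoint X = Y"
  unfolding adjoint_def
proof (rule the_equality)
  have "form (X (word u)) v = form (word u) (Y v)" for u v
    using Y
    by (induction v rule: free_induct)
      (simp_all add: form_word_left form_word_right XY lin_map_free_iff form_add_right
        form_scale_right lookup_add)
  then have adj: "form (X u) v = form u (Y v)" for u v
    using X
    by (induction u rule: free_induct) (simp_all add: lin_map_free_iff form_add_left form_scale_left)
  \<comment> \<open>Row \<open>w\<close> of \<open>Y\<close> is column \<open>w\<close> of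
    \<open>X\<close>, which has finite support as an element of the free algebra. This is the row
    finiteness required by \<open>End_V\<close>.\<close>
  have "{w'. form (word w) (Y (word w')) \<noteq> 0} = letters ` Poly_Mapping.keys (X (word w))" for w
    by (auto simp: form_word_right in_keys_iff simp flip: adj)
      (metis (no_types, lifting) image_eqI in_keys_iff mem_Collect_eq word.sel)
  then show "Y \<in> End_V \<and> (\<forall>u v. form (X u) v = form u (Y v))"
    using Y adj by (simp add: End_V_def)
  fix Z
  assume "Z \<in> End_V \<and> (\<forall>u v. form (X u) v = form u (Z v))"
  then have "form (word w) (Z v) = form (word w) (Y v)" for w v
    by (metis adj)
  then have "Poly_Mapping.lookup (Z v) w = Poly_Mapping.lookup (Y v) w" for v w
    by (metis form_word_left word.collapse)
  then show "Z = Y"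
    by (intro ext poly_mapping_eqI)
qed

lemma adjoint_ins: "adjoint (lin_ext (ins_word \<phi> \<psi> x)) = del \<phi> \<psi> x"
  by (rule adjoint_eqI) (simp_all add: lin_map_lin_ext lookup_ins_word del_def)

section \<open>The quotient by the q-Serre relations\<close>

text \<open>\<open>twist q x y\<close> is the eigenvalue on the letter \<open>y\<close> of \<open>K\<close> if \<open>x\<close> is \<open>letA\<close>, and of its inverse
  if \<open>x\<close> is \<open>letB\<close>.\<close>

definition twist :: "'f::field \<Rightarrow> letter \<Rightarrow> letter \<Rightarrow> 'f" where
  "twist q x y = q powi pairing y x"

text \<open>Working with \<open>x\<close> and \<open>other x\<close> treats A and B, and with them K
  and its inverse, simultaneously.\<close>

definition other :: "letter \<Rightarrow> letter" where
  "other x = (if x = letA then letB else letA)"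

lemma letter_cases: "y = x \<or> y = other x"
  by (cases x; cases y) (simp_all add: other_def)

lemma other_neq [simp]: "other x \<noteq> x" "x \<noteq> other x"
  by (auto simp: other_def)

lemma other_other [simp]: "other (other x) = x"
  by (cases x) (simp_all add: other_def)

lemma twist_simps [simp]:
  "twist q x x = q ^ 2" "twist q x (other x) = inverse q ^ 2" "twist q (other x) x = inverse q ^ 2"
  by (simp_all add: twist_def pairing_def power_int_minus power_inverse)

lemma serre_word:
  "serre q (gen x) (gen y) =
     (let t = (q ^ 3 - inverse q ^ 3) / (q - inverse q)
      in word [x, x, x, y] - scale t (word [x, x, y, x]) + scale t (word [x, y, x, x])
         - word [y, x, x, x])"
  by (simp add: serre_def Let_def gen_def word_mult power2_eq_square power3_eq_cube)

text \<open>All four words in the Serre element contain the same letters with multiplicity, so it is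
  an eigenvector of every diagonal map.\<close>

lemma diag_serre:
  "diag \<phi> (serre q (gen x) (gen y)) = scale (\<phi> x ^ 3 * \<phi> y) (serre q (gen x) (gen y))"
  by (simp add: serre_word Let_def diag_simps scale_add_right scale_diff_right power3_eq_cube
      mult_ac)

context
  fixes q :: "'f::field"
  assumes q_nonzero: "q \<noteq> 0" and q_square: "q ^ 2 \<noteq> 1"
begin

lemma twist_nonzero: "twist q x y \<noteq> 0"
  by (simp add: twist_def q_nonzero)

lemma twist_mult_other: "twist q x y * twist q (other x) y = 1"
  using letter_cases[of y x] q_nonzero by (auto simp flip: power_mult_distrib)

lemma weight_twist: "weight (twist q x) w = q powi (\<Sum>y\<leftarrow>w. pairing y x)"
  by (induction w) (simp_all add: twist_def power_int_add q_nonzero)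

text \<open>The assumption \<open>q ^ 2 \<noteq> 1\<close> makes the denominator nonzero, so [3]_q
  becomes a Laurent polynomial in q.\<close>

lemma three_q: "(q ^ 3 - inverse q ^ 3) / (q - inverse q) = q ^ 2 + 1 + inverse q ^ 2"
proof -
  have "q - inverse q \<noteq> 0"
    using q_nonzero q_square by (auto simp: field_simps power2_eq_square)
  then show ?thesis
    using q_nonzero by (simp add: field_simps power2_eq_square power3_eq_cube)
qed

section \<open>K and the shuffle adjoints as diagonal and deletion maps\<close>

lemma K_eq_diag: "K q = diag (twist q letA)"
proof -
  have "prod_list (map (\<lambda>x. scale (\<phi> x) (gen x)) w) = scale (weight \<phi> w) (word w)"
    for \<phi> :: "letter \<Rightarrow> 'f" and w
    by (induction w) (simp_all add: gen_mult_word mult.commute flip: one_eq_word)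
  moreover have "(\<lambda>x. case x of letA \<Rightarrow> scale (q ^ 2) (gen letA)
      | letB \<Rightarrow> scale (inverse q ^ 2) (gen letB)) = (\<lambda>x. scale (twist q letA x) (gen x))"
    using twist_simps[of q letA] by (auto simp: other_def split: letter.split)
  ultimately show ?thesis
    by (simp add: K_def alg_ext_def diag_def)
qed

lemma diag_twist_other: "diag (twist q x) \<circ> diag (twist q (other x)) = id"
  by (simp add: diag_comp twist_mult_other diag_one)

lemma K_inv_eq_diag: "K_inv q = diag (twist q letB)"
  unfolding K_inv_def K_eq_diag
  using diag_twist_other[of letA] diag_twist_other[of letB]
  by (intro inv_unique_comp) (simp_all add: other_def)

text \<open>In the product of \<open>x\<close> with \<open>v\<close> the exponent of q runs over the
  letters before the inserted one, so the weight on the right is 1.\<close>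

lemma adjoint_shuffle_l: "adjoint (shuffle_l q x) = del (twist q x) (\<lambda>_. 1) x"
proof -
  have "shuffle_l q x = lin_ext (ins_word (twist q x) (\<lambda>_. 1) x)"
    by (simp add: shuffle_l_def ins_word_def[abs_def] weight_twist)
  then show ?thesis by (simp add: adjoint_ins)
qed

lemma adjoint_shuffle_r: "adjoint (shuffle_r q x) = del (\<lambda>_. 1) (twist q x) x"
proof -
  have "shuffle_r q x = lin_ext (ins_word (\<lambda>_. 1) (twist q x) x)"
    by (simp add: shuffle_r_def ins_word_def[abs_def] weight_twist)
  then show ?thesis by (simp add: adjoint_ins)
qed

text \<open>Put z = \<open>other y\<close> and t = [3]_q. Deleting a \<open>y\<close> leaves the
  words yyz, yzy and zyy, whose coefficients cancel by t = q^2 + 1 + q^(-2). Deleting z leaves yyy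
  with coefficient q^(-6) - t q^(-4) + t q^(-2) - 1 = 0, up to sign.\<close>

lemma del_serre:
  "del (twist q x) (\<lambda>_. 1) x (serre q (gen y) (gen (other y))) = 0"
  "del (\<lambda>_. 1) (twist q x) x (serre q (gen y) (gen (other y))) = 0"
  using letter_cases[of x y] q_nonzero
  by (auto simp: serre_word three_q Let_def del_simps distrib_left scale_add_right gen_mult_word
        lookup_word lookup_add lookup_minus
      intro!: poly_mapping_eqI)
    (simp_all add: field_simps eval_nat_numeral)

section \<open>Invariance of J\<close>

lemma ideal_J: "ideal (J q) free_alg"
  by (simp add: J_def ring.genideal_ideal[OF ring_free_alg])

lemma diag_J:
  assumes "\<And>x. \<phi> x \<noteq> 0"
  shows "diag \<phi> ` J q = J q"
proof -
  \<comment> \<open>The preimage of J is an ideal containing the generators. The inclusion is shown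
    for every \<open>\<psi>\<close> so that the inverse weights can be used below for the reverse
    inclusion.\<close>
  have sub: "diag \<psi> ` J q \<subseteq> J q" for \<psi> :: "letter \<Rightarrow> 'f"
  proof -
    let ?S = "{serre q (gen letA) (gen letB), serre q (gen letB) (gen letA)}"
    have "?S \<subseteq> J q"
      unfolding J_def by (rule ring.genideal_self[OF ring_free_alg]) simp
    then have "?S \<subseteq> {p. diag \<psi> p \<in> J q}"
      by (auto simp: diag_serre ideal_scale[OF ideal_J])
    moreover have "ideal {p. diag \<psi> p \<in> J q} free_alg"
      by (intro ideal_free_algI)
        (auto simp: diag_mult diag_simps lin_map_zero[OF lin_map_diag] ideal_zero[OF ideal_J]
          intro: ideal_mult_left[OF ideal_J] ideal_mult_right[OF ideal_J] ideal_add[OF ideal_J])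
    ultimately have "J q \<subseteq> {p. diag \<psi> p \<in> J q}"
      unfolding J_def by (intro ring.genideal_minimal[OF ring_free_alg])
    then show ?thesis by auto
  qed
  have "p \<in> diag \<phi> ` J q" if "p \<in> J q" for p
  proof
    show "p = diag \<phi> (diag (\<lambda>x. inverse (\<phi> x)) p)"
      using diag_inverse(1)[of \<phi>] assms by (metis comp_apply id_apply)
    show "diag (\<lambda>x. inverse (\<phi> x)) p \<in> J q"
      using sub that by blast
  qed
  then show ?thesis
    using sub by blast
qed

text \<open>The generators of J are sent to 0, and a twisted derivation whose twists preserve J need
  only be checked on generators.\<close>

lemma del_J:
  "del (twist q x) (\<lambda>_. 1) x ` J q \<subseteq> J q"
  "del (\<lambda>_. 1) (twist q x) x ` J q \<subseteq> J q"
proof -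
  let ?S = "{serre q (gen letA) (gen letB), serre q (gen letB) (gen letA)}"
  note descend = derivation_preserves_Idl[where S = ?S, folded J_def, OF twisted_derivation_del]
  have "del (twist q x) (\<lambda>_. 1) x ` ?S \<subseteq> J q" "del (\<lambda>_. 1) (twist q x) x ` ?S \<subseteq> J q"
    using del_serre[of x letA] del_serre[of x letB] ideal_zero[OF ideal_J]
    by (simp_all add: other_def)
  then show "del (twist q x) (\<lambda>_. 1) x ` J q \<subseteq> J q" "del (\<lambda>_. 1) (twist q x) x ` J q \<subseteq> J q"
    by - (rule descend; simp add: twist_nonzero diag_J)+
qed

section \<open>Descent to V/J\<close>

lemma twisted_derivation_VJ:
  assumes "twisted_derivation free_alg \<phi> \<psi> \<delta>" "\<phi> ` J q = J q" "\<psi> ` J q = J q" "\<delta> ` J q \<subseteq> J q"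
  shows "twisted_derivation (VJ q) (on_VJ q \<phi>) (on_VJ q \<psi>) (on_VJ q \<delta>)"
  unfolding VJ_def on_VJ_def using ideal_J assms by (rule twisted_derivation_induced)

text \<open>Reduces the claim about V/J, for the prescribed operator and for every module structure
  \<open>\<rho>\<close>, to a statement on the free algebra and invariance of J.\<close>

lemma acts_as_derivation_left:
  assumes "twisted_derivation free_alg (diag (twist q x)) id (box_op q T i)"
    and "box_op q T i ` J q \<subseteq> J q"
  shows "acts_as_derivation q T i (on_VJ q (diag (twist q x))) id"
proof -
  have "twisted_derivation (VJ q) (on_VJ q (diag (twist q x))) (on_VJ q id) (on_VJ q (box_op q T i))"
    using assms by (intro twisted_derivation_VJ) (simp_all add: diag_J twist_nonzero)
  moreover from this have "alg_automorphism (VJ q) (on_VJ q (diag (twist q x)))"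
    by (simp add: twisted_derivation_def)
  ultimately show ?thesis
    unfolding acts_as_derivation_def box_structure_def VJ_def on_VJ_def
    by (auto elim!: twisted_derivation_quot_cong[OF ideal_J]
        simp: induced_id[OF ideal_J] alg_automorphism_quot_id[OF ideal_J])
qed

lemma acts_as_derivation_right:
  assumes "twisted_derivation free_alg id (diag (twist q x)) (box_op q T i)"
    and "box_op q T i ` J q \<subseteq> J q"
  shows "acts_as_derivation q T i id (on_VJ q (diag (twist q x)))"
proof -
  have "twisted_derivation (VJ q) (on_VJ q id) (on_VJ q (diag (twist q x))) (on_VJ q (box_op q T i))"
    using assms by (intro twisted_derivation_VJ) (simp_all add: diag_J twist_nonzero)
  moreover from this have "alg_automorphism (VJ q) (on_VJ q (diag (twist q x)))"
    by (simp add: twisted_derivation_def)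
  ultimately show ?thesis
    unfolding acts_as_derivation_def box_structure_def VJ_def on_VJ_def
    by (auto elim!: twisted_derivation_quot_cong[OF ideal_J]
        simp: induced_id[OF ideal_J] alg_automorphism_quot_id[OF ideal_J])
qed

lemma twisted_derivation_del_twist:
  "twisted_derivation free_alg (diag (twist q x)) id (del (twist q x) (\<lambda>_. 1) x)"
  "twisted_derivation free_alg id (diag (twist q x)) (del (\<lambda>_. 1) (twist q x) x)"
  using twisted_derivation_del[of "twist q x" "\<lambda>_. 1" x] twisted_derivation_del[of "\<lambda>_. 1" "twist q x" x]
  by (simp_all add: twist_nonzero diag_one)

text \<open>These are the operators of types I, IS, IT and IST. Composing the subtracted deletion
  with \<open>diag (twist q x)\<close> cancels the twist by \<open>other x\<close> and moves it to
  the opposite side, so both terms obey the same Leibniz rule.\<close>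

lemma twisted_derivation_mixed:
  "twisted_derivation free_alg (diag (twist q x)) id
     (\<lambda>v. scale c (del (twist q x) (\<lambda>_. 1) x v
        - del (\<lambda>_. 1) (twist q (other x)) (other x) (diag (twist q x) v)))"
  "twisted_derivation free_alg id (diag (twist q x))
     (\<lambda>v. scale c (del (\<lambda>_. 1) (twist q x) x v
        - del (twist q (other x)) (\<lambda>_. 1) (other x) (diag (twist q x) v)))"
proof -
  have aut: "alg_automorphism free_alg (diag (twist q x))"
    "alg_automorphism free_alg (id :: 'f V \<Rightarrow> _)"
    using alg_automorphism_diag[of "\<lambda>_. 1"] by (simp_all add: alg_automorphism_diag twist_nonzero diag_one)
  have cancel: "diag (twist q (other x)) \<circ> diag (twist q x) = id"
    using diag_twist_other[of "other x"] by simp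
  have "twisted_derivation free_alg (diag (twist q x)) id
      (del (\<lambda>_. 1) (twist q (other x)) (other x) \<circ> diag (twist q x))"
    using derivation_comp[OF twisted_derivation_del_twist(2)[of "other x"] aut(1)] aut cancel by simp
  then show "twisted_derivation free_alg (diag (twist q x)) id
     (\<lambda>v. scale c (del (twist q x) (\<lambda>_. 1) x v
        - del (\<lambda>_. 1) (twist q (other x)) (other x) (diag (twist q x) v)))"
    using derivation_scale_diff[OF twisted_derivation_del_twist(1)] by (simp add: comp_def)
  have "twisted_derivation free_alg id (diag (twist q x))
      (del (twist q (other x)) (\<lambda>_. 1) (other x) \<circ> diag (twist q x))"
    using derivation_comp[OF twisted_derivation_del_twist(1)[of "other x"] aut(1)] aut cancel by simp
  then show "twisted_derivation free_alg id (diag (twist q x))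
     (\<lambda>v. scale c (del (\<lambda>_. 1) (twist q x) x v
        - del (twist q (other x)) (\<lambda>_. 1) (other x) (diag (twist q x) v)))"
    using derivation_scale_diff[OF twisted_derivation_del_twist(2)] by (simp add: comp_def)
qed

lemma mixed_J:
  "(\<lambda>v. scale c (del (twist q x) (\<lambda>_. 1) x v
      - del (\<lambda>_. 1) (twist q y) y (diag (twist q x) v))) ` J q \<subseteq> J q"
  "(\<lambda>v. scale c (del (\<lambda>_. 1) (twist q x) x v
      - del (twist q y) (\<lambda>_. 1) y (diag (twist q x) v))) ` J q \<subseteq> J q"
  using del_J diag_J[of "twist q x"]
  by (auto simp: twist_nonzero image_subset_iff set_eq_subset
      intro!: ideal_scale[OF ideal_J] ideal_diff[OF ideal_J])

lemmas box_op_eqs = box_op_def Let_def adjoint_shuffle_l adjoint_shuffle_r K_eq_diag K_inv_eq_diag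

end

theorem theorem1p3:
  fixes q :: "'f::field"
  assumes "q \<noteq> 0"
    and "\<forall>n::nat. n > 0 \<longrightarrow> q ^ n \<noteq> 1"
  shows
    "(\<forall>T \<in> {Type_I, Type_II}.
        acts_as_derivation q T 1 (on_VJ q (K q)) id \<and>
        acts_as_derivation q T 3 (on_VJ q (K_inv q)) id) \<and>
     (\<forall>T \<in> {Type_IS, Type_IIS}.
        acts_as_derivation q T 1 id (on_VJ q (K q)) \<and>
        acts_as_derivation q T 3 id (on_VJ q (K_inv q))) \<and>
     (\<forall>T \<in> {Type_IT, Type_IIT}.
        acts_as_derivation q T 1 (on_VJ q (K_inv q)) id \<and>
        acts_as_derivation q T 3 (on_VJ q (K q)) id) \<and>
     (\<forall>T \<in> {Type_IST, Type_IIST}.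
        acts_as_derivation q T 1 id (on_VJ q (K_inv q)) \<and>
        acts_as_derivation q T 3 id (on_VJ q (K q)))"
proof -
  have "q ^ 2 \<noteq> 1"
    using assms(2) by (metis zero_less_numeral)
  note q = assms(1) this
  have other: "other letA = letB" "other letB = letA"
    by (simp_all add: other_def)
  note eqs = box_op_eqs[OF q] K_eq_diag[OF q] K_inv_eq_diag[OF q]
  show ?thesis
    \<comment> \<open>The types based on I use the mixed operators with scalar
      \<open>1 - q ^ 2\<close>; those based on II use the bare deletions. Removing
      \<open>subsetI\<close> keeps the invariance goals as inclusions, the form in which
      \<open>mixed_J\<close> and \<open>del_J\<close> supply them.\<close>
    using twisted_derivation_mixed[OF q, of letA] twisted_derivation_mixed[OF q, of letB]
    by (auto simp: eqs other mixed_J[OF q] del_J[OF q] twisted_derivation_del_twist[OF q]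
        intro!: acts_as_derivation_left[OF q] acts_as_derivation_right[OF q] del: subsetI)
qed

end
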